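(* Consider the Energy Sharing Game $(N,v)$ with admission fees $c_i\ge 0$, $i\in U$. Let $\varepsilon^*$ be its least core value, let $m_a=\min\{x_a:x\in C_{\varepsilon^*}(N,v)\}$ be the minimum share of the aggregator in the least core, and let $\mathcal{P}(U)$ be the set of all partitions of $U$. Then: (a) $$m_a\ \ge\ v(N)-\min\Big\{|\mathcal{A}|\,(v(N)-\varepsilon^* )-\sum_{S\in\mathcal{A}}v(N\setminus S):\ \mathcal{A}\in\mathcal{P}(U)\Big\};$$ (b) equality holds in (a) if and only if there exists an optimal solution $\lambda^*$ of the linear program $(D_U^* )$ such that $\mathcal{A}^*=\{S:\lambda^*_{N\setminus S}>0\}$ belongs to $\mathcal{P}(U)$.
   Context: Energy Sharing Game. The player set is $N=U\cup\{a\}$, where $U$ is a finite set of users with $|U|\ge 2$ and $a\notin U$ is the aggregator. Fix an integer $m\ge 1$. Each user $i\in U$ has: a compact set $D_i\subseteq\mathbb{R}^{n_i}\times\mathbb{R}^{2m}_+$, whose points are written $(z_i,y_i)$ with $y_i=[y_i^+,y_i^-]\in\mathbb{R}^m_+\times\mathbb{R}^m_+$, such that $D_i^z=\{z_i\in\mathbb{R}^{n_i}:(z_i,0)\in D_i\}$ is nonempty; a continuous function $f_i:\mathbb{R}^{n_i+2m}\to\mathbb{R}$; and an admission fee $c_i\ge 0$. There is also a continuous function $f_a:\mathbb{R}^m\to\mathbb{R}_+$ with $f_a(0)=0$. Put $b_i=\max\{f_i(z_i,0):z_i\in D_i^z\}$ and, for $S\subseteq N$ with $a\in S$ and $|S\cap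 U|\ge 2$, $$b_S=\max\Big\{\sum_{i\in S\cap U} [f_i(z_i,y_i)-c_i]+f_a\Big(\sum_{i\in S\cap U}y_i^+\Big):\ (z_i,y_i)\in D_i\ (i\in S\cap U),\ \sum_{i\in S\cap U}y_i^+=\sum_{i\in S\cap U}y_i^-\Big\}.$$ The characteristic function is $v(S)=b_S-\sum_{i\in S\cap U}b_i$ if $a\in S$ and $|S\cap U|\ge 2$, and $v(S)=0$ for every other $S\subseteq N$. Notation: $\mathcal{P}=\{S\subseteq N:S\ne\emptyset,S\ne N\}$, $\mathcal{P}^a=\{S\in\mathcal{P}:a\in S\}$, $\mathcal{P}^{-a}=\mathcal{P}\setminus\mathcal{P}^a$, and for $i\in U$, $\mathcal{P}^a_{-i}=\{S\in\mathcal{P}^a:i\notin S\}$, $\mathcal{P}^{-a}_i=\{S\in\mathcal{P}^{-a}:i\in S\}$. For $x\in\mathbb{R}^{|N|}$, $x(S)=\sum_{i\in S}x_i$. The strong $\varepsilon$-core is $C_\varepsilon(N,v)=\{x\in\mathbb{R}^{|N|}:x(N)=v(N),\ x(S)\ge v(S)+\varepsilon\ \forall S\in\mathcal{P}\}$. The least core value $\varepsilon^*$ is the largest $\varepsilon\in\mathbb{R}$ with $C_\varepsilon(N,v)\ne\emptyset$, and $C_{\varepsilon^*}(N,v)$ is the least core. The linear program $(D_U^* )$, in variables $\lambda=(\lambda_S)_{S\in\mathcal{P}}$, is $$\min\ \sum_{S\in\mathcal{P}^a}[v(N)-v(S)-\varepsilon^*]\lambda_S-\varepsilon^*\sum_{S\in\mathcal{P}^{-a}}\lambda_S\quad\text{s.t.}\quad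 \sum_{S\in\mathcal{P}^a_{-i}}\lambda_S-\sum_{S\in\mathcal{P}^{-a}_i}\lambda_S=1\ (i\in U),\quad \lambda_S\ge 0\ (S\in\mathcal{P}).$$ It is the dual of the program of maximizing $x(U)$ over $x\in\mathbb{R}^{|U|}$ subject to $x(S)\ge\varepsilon^*$ for $S\in\mathcal{P}^{-a}$ and $x(N\setminus S)\le v(N)-v(S)-\varepsilon^*$ for $S\in\mathcal{P}^a$. In (b), $S$ ranges over $\mathcal{P}$. *)

theory Defs
  imports "HOL-Analysis.Analysis" "HOL-Library.Disjoint_Sets"
begin

text \<open>
  Throughout, the space of real vectors indexed by a finite set \<open>I\<close> is \<open>extensional I\<close>, the set of
  functions to the reals that are \<open>undefined\<close> outside \<open>I\<close>. With the product topology on functions,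
  \<open>extensional {..<n}\<close> is a copy of Euclidean n-space; this allows a different dimension for each
  user. Maxima and minima over infinite sets are written with \<open>GREATEST\<close> and \<open>LEAST\<close>, which denote
  an attained extremum.
\<close>

definition proper_coalitions :: "'p set \<Rightarrow> 'p set set" where
  "proper_coalitions N = {S. S \<subseteq> N \<and> S \<noteq> {} \<and> S \<noteq> N}"

definition strong_core :: "'p set \<Rightarrow> ('p set \<Rightarrow> real) \<Rightarrow> real \<Rightarrow> ('p \<Rightarrow> real) set" where
  "strong_core N v \<epsilon> = {x \<in> extensional N.
     (\<Sum>i\<in>N. x i) = v N \<and> (\<forall>S \<in> proper_coalitions N. (\<Sum>i\<in>S. x i) \<ge> v S + \<epsilon>)}"

definition least_core_value :: "'p set \<Rightarrow> ('p set \<Rightarrow> real) \<Rightarrow> real" where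
  "least_core_value N v = (GREATEST \<epsilon>. strong_core N v \<epsilon> \<noteq> {})"

definition least_core :: "'p set \<Rightarrow> ('p set \<Rightarrow> real) \<Rightarrow> ('p \<Rightarrow> real) set" where
  "least_core N v = strong_core N v (least_core_value N v)"

definition min_share :: "'p set \<Rightarrow> ('p set \<Rightarrow> real) \<Rightarrow> 'p \<Rightarrow> real" where
  "min_share N v j = (LEAST t. t \<in> {x j | x. x \<in> least_core N v})"

text \<open>A point \<open>(z, yp, ym)\<close> holds the internal decision and the two nonnegative halves of \<open>y\<close>.\<close>

type_synonym 'm point = "(nat \<Rightarrow> real) \<times> (real ^ 'm) \<times> (real ^ 'm)"

definition ypos :: "'m point \<Rightarrow> real ^ 'm" where
  "ypos p = fst (snd p)"

definition yneg :: "'m point \<Rightarrow> real ^ 'm" where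
  "yneg p = snd (snd p)"

definition user_benefit :: "('m::finite) point set \<Rightarrow> ('m point \<Rightarrow> real) \<Rightarrow> real" where
  "user_benefit Di fi = (GREATEST r. r \<in> {fi (z, 0) | z. (z, 0) \<in> Di})"

definition coalition_benefit ::
  "('p \<Rightarrow> ('m::finite) point set) \<Rightarrow> ('p \<Rightarrow> 'm point \<Rightarrow> real) \<Rightarrow> ('p \<Rightarrow> real) \<Rightarrow> (real ^ 'm \<Rightarrow> real)
    \<Rightarrow> 'p set \<Rightarrow> real" where
  "coalition_benefit D f c fa T = (GREATEST r. r \<in>
     {(\<Sum>i\<in>T. f i (p i) - c i) + fa (\<Sum>i\<in>T. ypos (p i)) | p.
        (\<forall>i\<in>T. p i \<in> D i) \<and> (\<Sum>i\<in>T. ypos (p i)) = (\<Sum>i\<in>T. yneg (p i))})"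

definition sharing_value ::
  "'p set \<Rightarrow> 'p \<Rightarrow> ('p \<Rightarrow> ('m::finite) point set) \<Rightarrow> ('p \<Rightarrow> 'm point \<Rightarrow> real) \<Rightarrow> ('p \<Rightarrow> real)
    \<Rightarrow> (real ^ 'm \<Rightarrow> real) \<Rightarrow> 'p set \<Rightarrow> real" where
  "sharing_value U a D f c fa S =
     (if a \<in> S \<and> card (S \<inter> U) \<ge> 2
      then coalition_benefit D f c fa (S \<inter> U) - (\<Sum>i\<in>S \<inter> U. user_benefit (D i) (f i))
      else 0)"

definition dual_feasible :: "'p set \<Rightarrow> 'p \<Rightarrow> ('p set \<Rightarrow> real) \<Rightarrow> bool" where
  "dual_feasible U a lam \<longleftrightarrow>
     (let P = proper_coalitions (insert a U) in
       lam \<in> extensional P \<and> (\<forall>S\<in>P. lam S \<ge> 0) \<and>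
       (\<forall>i\<in>U. (\<Sum>S | S \<in> P \<and> a \<in> S \<and> i \<notin> S. lam S) - (\<Sum>S | S \<in> P \<and> a \<notin> S \<and> i \<in> S. lam S) = 1))"

definition dual_objective ::
  "'p set \<Rightarrow> 'p \<Rightarrow> ('p set \<Rightarrow> real) \<Rightarrow> ('p set \<Rightarrow> real) \<Rightarrow> real" where
  "dual_objective U a v lam =
     (let N = insert a U; P = proper_coalitions N; \<epsilon> = least_core_value N v in
       (\<Sum>S | S \<in> P \<and> a \<in> S. (v N - v S - \<epsilon>) * lam S) - \<epsilon> * (\<Sum>S | S \<in> P \<and> a \<notin> S. lam S))"

definition dual_optimal :: "'p set \<Rightarrow> 'p \<Rightarrow> ('p set \<Rightarrow> real) \<Rightarrow> ('p set \<Rightarrow> real) \<Rightarrow> bool" where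
  "dual_optimal U a v lam \<longleftrightarrow>
     dual_feasible U a lam \<and>
     (\<forall>mu. dual_feasible U a mu \<longrightarrow> dual_objective U a v lam \<le> dual_objective U a v mu)"

end

theory Submission
  imports Defs
begin

text \<open>
  The only property of the characteristic function that matters is that it vanishes on coalitions
  without the aggregator. The aggregator's complementary share \<open>v N - x a\<close> over the least core is
  then the objective \<open>x(U)\<close> of a linear program. Every partition of \<open>U\<close> yields a feasible point of
  the dual, with multiplier 1 on the complements of its parts, and weak duality gives the bound.
  Conversely, the dual constraint at \<open>i\<close> forces multiplier 1 whenever the complements of the
  support form a partition, so such a solution is one of these points, and the absence of a duality
  gap settles the equality case. Attained extrema and strong duality both rest on Farkas' lemma.
\<close>

section \<open>Farkas' lemma and linear feasibility\<close>

text \<open>Induction on the rows. If the rows in \<open>J\<close> already force the conclusion, row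
  \<open>k\<close> gets multiplier 0. Otherwise some \<open>z\<close> obeys them but violates the
  conclusion, hence violates row \<open>k\<close>; projecting along \<open>z\<close> eliminates row
  \<open>k\<close>, whose multiplier is recovered afterwards.\<close>

lemma farkas_homogeneous:
  fixes A :: "'j \<Rightarrow> 'i \<Rightarrow> real" and b :: "'i \<Rightarrow> real"
  assumes "finite J" and I: "finite I"
    and "\<And>x. (\<forall>j\<in>J. (\<Sum>i\<in>I. A j i * x i) \<le> 0) \<Longrightarrow> (\<Sum>i\<in>I. b i * x i) \<le> 0"
  shows "\<exists>y. (\<forall>j\<in>J. 0 \<le> y j) \<and> (\<forall>i\<in>I. b i = (\<Sum>j\<in>J. y j * A j i))"
  using assms(1,3)
proof (induction J arbitrary: A b rule: finite_induct)
  case empty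
  \<comment> \<open>Without rows the premise holds for every vector, in particular for
    \<open>b\<close> itself.\<close>
  have "(\<Sum>i\<in>I. b i * b i) = 0"
    using empty[of b] by (intro antisym sum_nonneg) auto
  then have "\<forall>i\<in>I. b i = 0"
    using I by (subst (asm) sum_nonneg_eq_0_iff) auto
  then show ?case by auto
next
  case (insert k J)
  define L where "L r x = (\<Sum>i\<in>I. r i * x i)" for r x :: "'i \<Rightarrow> real"
  have L_row: "L (\<lambda>i. r i - s * q i) x = L r x - s * L q x" for r q x and s :: real
    by (simp add: L_def left_diff_distrib sum_subtractf sum_distrib_left mult.assoc)
  have L_arg: "L r (\<lambda>i. x i - s * z i) = L r x - s * L r z" for r x z and s :: real
    by (simp add: L_def right_diff_distrib sum_subtractf sum_distrib_left algebra_simps)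
  note prem = insert.prems[folded L_def] and IH = insert.IH[folded L_def]
  show ?case
  proof (cases "\<forall>x. (\<forall>j\<in>J. L (A j) x \<le> 0) \<longrightarrow> L b x \<le> 0")
    case True
    then obtain y where y: "\<forall>j\<in>J. 0 \<le> y j" "\<forall>i\<in>I. b i = (\<Sum>j\<in>J. y j * A j i)"
      using IH[of A b] by blast
    have "(\<Sum>j\<in>J. (y(k := 0)) j * A j i) = (\<Sum>j\<in>J. y j * A j i)" for i
      using insert.hyps by (intro sum.cong) auto
    then show ?thesis
      using y insert.hyps by (intro exI[of _ "y(k := 0)"]) auto
  next
    case False
    then obtain z where z: "\<forall>j\<in>J. L (A j) z \<le> 0" "L b z > 0" by force
    define \<kappa> where "\<kappa> = L (A k) z"
    have \<kappa>: "\<kappa> > 0" using prem[of z] z unfolding \<kappa>_def by force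
    define A' where "A' = (\<lambda>j i. A j i - L (A j) z / \<kappa> * A k i)"
    define b' where "b' = (\<lambda>i. b i - L b z / \<kappa> * A k i)"
    \<comment> \<open>The projection along \<open>z\<close> onto the kernel of row \<open>k\<close> makes constraint \<open>k\<close> vacuous.\<close>
    have "L b' x \<le> 0" if "\<forall>j\<in>J. L (A' j) x \<le> 0" for x
    proof -
      define w where "w = (\<lambda>i. x i - L (A k) x / \<kappa> * z i)"
      have "L (A j) w = L (A' j) x" for j
        unfolding w_def A'_def L_row L_arg by simp
      moreover have "L (A k) w = 0" 
        using \<kappa> unfolding w_def L_arg by (simp flip: \<kappa>_def)
      ultimately have "L b w \<le> 0" using that by (intro prem) auto
      then show ?thesis
        unfolding w_def b'_def L_row L_arg by (simp add: mult.commute)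
    qed
    then obtain y where y: "\<forall>j\<in>J. 0 \<le> y j" "\<forall>i\<in>I. b' i = (\<Sum>j\<in>J. y j * A' j i)"
      using IH[of A' b'] by blast
    \<comment> \<open>This is the coefficient that \<open>A k\<close> collects when the definitions
      of \<open>A'\<close> and \<open>b'\<close> are expanded in the combination. It is nonnegative
      because \<open>z\<close> makes \<open>L b\<close> positive and no \<open>L (A j)\<close>
      positive.\<close>
    define s where "s = (L b z - (\<Sum>j\<in>J. y j * L (A j) z)) / \<kappa>"
    have "(\<Sum>j\<in>J. y j * L (A j) z) \<le> 0"
      using y z by (intro sum_nonpos mult_nonneg_nonpos) auto
    then have "s \<ge> 0" using z \<kappa> by (simp add: s_def)
    have "b i = s * A k i + (\<Sum>j\<in>J. (y(k := s)) j * A j i)" if "i \<in> I" for i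
    proof -
      have "b i = L b z / \<kappa> * A k i + (\<Sum>j\<in>J. y j * A' j i)"
        using y that by (simp add: b'_def flip: y)
      also have "(\<Sum>j\<in>J. y j * A' j i)
          = (\<Sum>j\<in>J. y j * A j i) - (\<Sum>j\<in>J. y j * L (A j) z) / \<kappa> * A k i"
        by (simp add: A'_def right_diff_distrib sum_subtractf sum_distrib_right
            sum_divide_distrib mult.assoc)
      also have "(\<Sum>j\<in>J. y j * A j i) = (\<Sum>j\<in>J. (y(k := s)) j * A j i)"
        using insert.hyps by (intro sum.cong) auto
      finally show ?thesis by (simp add: s_def diff_divide_distrib left_diff_distrib)
    qed
    then show ?thesis
      using y \<open>s \<ge> 0\<close> insert.hyps by (intro exI[of _ "y(k := s)"]) auto
  qed
qed

text \<open>Infeasibility means that no solution of the homogenized system has a positive scale,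
  since dividing by the scale would solve the original system. So the homogenized rows imply scale
  at most 0, and the multipliers for this implication satisfy even
  \<open>(\<Sum>j\<in>J. y j * b j) = - 1\<close>.\<close>

lemma farkas:
  fixes A :: "'j \<Rightarrow> 'i \<Rightarrow> real" and b :: "'j \<Rightarrow> real"
  assumes "finite J" and I: "finite I"
    and infeasible: "\<nexists>x. \<forall>j\<in>J. (\<Sum>i\<in>I. A j i * x i) \<le> b j"
  shows "\<exists>y. (\<forall>j\<in>J. 0 \<le> y j) \<and> (\<forall>i\<in>I. (\<Sum>j\<in>J. y j * A j i) = 0) \<and>
    (\<Sum>j\<in>J. y j * b j) < 0"
proof -
  \<comment> \<open>Homogenization: coordinate \<open>None\<close> scales the right-hand side.\<close>
  define A' where "A' = (\<lambda>j. case_option (- b j) (A j))"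
  define e where "e = case_option 1 (\<lambda>_::'i. 0::real)"
  let ?I = "insert None (Some ` I)"
  have sums: "(\<Sum>i\<in>?I. r i * x i) = r None * x None + (\<Sum>i\<in>I. r (Some i) * x (Some i))"
    for r x :: "'i option \<Rightarrow> real"
    using I by (simp add: sum.reindex)
  have "(\<Sum>i\<in>?I. e i * x i) \<le> 0" if x: "\<forall>j\<in>J. (\<Sum>i\<in>?I. A' j i * x i) \<le> 0" for x
  proof (rule ccontr)
    assume "\<not> ?thesis"
    then have pos: "x None > 0" by (simp only: sums) (simp add: e_def)
    have "(\<Sum>i\<in>I. A j i * (x (Some i) / x None)) \<le> b j" if "j \<in> J" for j
    proof -
      have "(\<Sum>i\<in>I. A j i * x (Some i)) \<le> b j * x None"
        using x that by (simp only: sums) (simp add: A'_def)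
      then show ?thesis using pos by (simp add: pos_divide_le_eq flip: sum_divide_distrib)
    qed
    then have "\<exists>x. \<forall>j\<in>J. (\<Sum>i\<in>I. A j i * x i) \<le> b j"
      by (intro exI[of _ "\<lambda>i. x (Some i) / x None"]) auto
    with infeasible show False by blast
  qed
  then obtain y where y: "\<forall>j\<in>J. 0 \<le> y j" "\<forall>i\<in>?I. e i = (\<Sum>j\<in>J. y j * A' j i)"
    using farkas_homogeneous[of J ?I A' e] assms by blast
  have "(\<Sum>j\<in>J. y j * A j i) = 0" if "i \<in> I" for i
    using bspec[OF y(2), of "Some i"] that by (simp add: A'_def e_def)
  moreover have "(\<Sum>j\<in>J. y j * b j) = - 1"
    using bspec[OF y(2), of None] by (simp add: A'_def e_def sum_negf)
  ultimately show ?thesis using y by (intro exI[of _ y]) auto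
qed

text \<open>The easy half of duality: weighting the inequalities and exchanging the sums. It serves
  for the soundness of Farkas certificates as well as for weak duality.\<close>

lemma certificate_bound:
  fixes A :: "'j \<Rightarrow> 'i \<Rightarrow> real" and b :: "'j \<Rightarrow> real"
  assumes "\<And>j. j \<in> J \<Longrightarrow> 0 \<le> y j" "\<And>j. j \<in> J \<Longrightarrow> (\<Sum>i\<in>I. A j i * x i) \<le> b j"
  shows "(\<Sum>i\<in>I. (\<Sum>j\<in>J. y j * A j i) * x i) \<le> (\<Sum>j\<in>J. y j * b j)"
proof -
  have "(\<Sum>i\<in>I. (\<Sum>j\<in>J. y j * A j i) * x i) = (\<Sum>j\<in>J. y j * (\<Sum>i\<in>I. A j i * x i))"
    unfolding sum_distrib_left sum_distrib_right by (subst sum.swap) (simp add: mult.assoc)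
  also have "\<dots> \<le> (\<Sum>j\<in>J. y j * b j)"
    using assms by (intro sum_mono mult_left_mono) auto
  finally show ?thesis .
qed

text \<open>By Farkas' lemma, \<open>t\<close> is feasible iff every certificate \<open>y\<close>
  gives a nonnegative value. Each of these conditions is a nonstrict inequality affine in
  \<open>t\<close>, so their intersection is closed. This is what makes the extrema below
  attained.\<close>

lemma closed_feasible_parameters:
  fixes A :: "'j \<Rightarrow> 'i \<Rightarrow> real" and b d :: "'j \<Rightarrow> real"
  assumes "finite J" "finite I"
  shows "closed {t. \<exists>x. \<forall>j\<in>J. (\<Sum>i\<in>I. A j i * x i) \<le> b j + t * d j}"
proof -
  let ?Y = "{y. (\<forall>j\<in>J. 0 \<le> y j) \<and> (\<forall>i\<in>I. (\<Sum>j\<in>J. y j * A j i) = 0)}"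
  have "{t. \<exists>x. \<forall>j\<in>J. (\<Sum>i\<in>I. A j i * x i) \<le> b j + t * d j}
      = (\<Inter>y\<in>?Y. {t. 0 \<le> (\<Sum>j\<in>J. y j * (b j + t * d j))})" (is "?F = ?G")
  proof (intro equalityI subsetI)
    fix t assume "t \<in> ?F"
    then obtain x where "\<And>j. j \<in> J \<Longrightarrow> (\<Sum>i\<in>I. A j i * x i) \<le> b j + t * d j" by auto
    then have "(\<Sum>i\<in>I. (\<Sum>j\<in>J. y j * A j i) * x i) \<le> (\<Sum>j\<in>J. y j * (b j + t * d j))"
      if "y \<in> ?Y" for y
      using that by (intro certificate_bound) auto
    then show "t \<in> ?G" by simp
  next
    fix t assume t: "t \<in> ?G"
    show "t \<in> ?F"
    proof (rule ccontr)
      assume "t \<notin> ?F"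
      then have "\<nexists>x. \<forall>j\<in>J. (\<Sum>i\<in>I. A j i * x i) \<le> b j + t * d j" by simp
      then obtain y where y: "\<forall>j\<in>J. 0 \<le> y j" "\<forall>i\<in>I. (\<Sum>j\<in>J. y j * A j i) = 0"
          "(\<Sum>j\<in>J. y j * (b j + t * d j)) < 0"
        using farkas[OF assms] by fast
      then have "0 \<le> (\<Sum>j\<in>J. y j * (b j + t * d j))"
        using t by simp
      with y(3) show False by simp
    qed
  qed
  moreover have "closed {t. 0 \<le> (\<Sum>j\<in>J. y j * (b j + t * d j))}" for y
    by (intro closed_Collect_le continuous_intros)
  ultimately show ?thesis by auto
qed

section \<open>The core as a linear system in the users' shares\<close>

locale aggregator_game =
  fixes U :: "'p set" and a :: 'p and v :: "'p set \<Rightarrow> real"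
  assumes finite_U: "finite U" and U_nonempty: "U \<noteq> {}" and a_notin_U: "a \<notin> U"
    and v_without_a: "a \<notin> S \<Longrightarrow> v S = 0"
begin

abbreviation "N \<equiv> insert a U"
abbreviation "P \<equiv> proper_coalitions N"
abbreviation "\<epsilon>\<^sub>0 \<equiv> least_core_value N v"
abbreviation "m\<^sub>a \<equiv> min_share N v a"

text \<open>
  The coefficients and right-hand sides of the linear program obtained from the core constraints
  by substituting \<open>x a = v N - x(U)\<close>. Its dual is the program of \<open>dual_optimal\<close>.
\<close>

definition row :: "'p set \<Rightarrow> 'p \<Rightarrow> real" where
  "row S i = (if a \<in> S then of_bool (i \<notin> S) else - of_bool (i \<in> S))"

definition rhs :: "real \<Rightarrow> 'p set \<Rightarrow> real" where
  "rhs \<epsilon> S = (if a \<in> S then v N - v S - \<epsilon> else - \<epsilon>)"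

lemma finite_P: "finite P"
  using finite_U by (auto simp: proper_coalitions_def)

lemma diff_in_P_iff: "S \<subseteq> N \<Longrightarrow> N - S \<in> P \<longleftrightarrow> S \<in> P"
  by (auto simp: proper_coalitions_def)

lemma singleton_a_in_P: "{a} \<in> P" and U_in_P: "U \<in> P"
  using U_nonempty a_notin_U by (auto simp: proper_coalitions_def)

lemma sum_row:
  assumes "S \<subseteq> N"
  shows "(\<Sum>i\<in>U. row S i * x i) = (if a \<in> S then sum x U - sum x (S - {a}) else - sum x S)"
proof (cases "a \<in> S")
  case True
  then have "(\<Sum>i\<in>U. row S i * x i) = (\<Sum>i\<in>U - S. x i)"
    using finite_U by (auto simp: row_def intro!: sum.mono_neutral_cong_right)
  also have "U - S = U - (S - {a})" using a_notin_U by auto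
  also have "sum x \<dots> = sum x U - sum x (S - {a})"
    using assms finite_U by (intro sum_diff) auto
  finally show ?thesis using True by simp
next
  case False
  then have "(\<Sum>i\<in>U. row S i * x i) = (\<Sum>i\<in>S. - x i)"
    using assms finite_U by (intro sum.mono_neutral_cong_right) (auto simp: row_def)
  then show ?thesis using False by (simp add: sum_negf)
qed

text \<open>Efficiency eliminates \<open>x a\<close>. For a coalition without \<open>a\<close>, the
  right-hand side is \<open>- \<epsilon>\<close> because \<open>v S = 0\<close>.\<close>

lemma core_constraint_iff:
  assumes "S \<in> P" "sum x N = v N"
  shows "v S + \<epsilon> \<le> sum x S \<longleftrightarrow> (\<Sum>i\<in>U. row S i * x i) \<le> rhs \<epsilon> S"
proof -
  have S: "S \<subseteq> N" "finite S"
    using assms(1) finite_U by (auto simp: proper_coalitions_def intro: finite_subset)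
  have "sum x U = v N - x a" using assms(2) finite_U a_notin_U by simp
  moreover have "sum x S = x a + sum x (S - {a})" if "a \<in> S"
    using S that by (simp add: sum.remove)
  ultimately show ?thesis
    using v_without_a[of S] by (auto simp: sum_row[OF S(1)] rhs_def)
qed

text \<open>The aggregator receives what the users leave, so fixing its share is fixing
  x(U).\<close>

lemma core_share_iff:
  "(\<exists>x\<in>strong_core N v \<epsilon>. x a = t) \<longleftrightarrow>
    (\<exists>x. (\<forall>S\<in>P. (\<Sum>i\<in>U. row S i * x i) \<le> rhs \<epsilon> S) \<and> sum x U = v N - t)"
proof
  assume "\<exists>x\<in>strong_core N v \<epsilon>. x a = t"
  then obtain x where x: "x \<in> strong_core N v \<epsilon>" "x a = t" by blast
  then have "sum x N = v N" and "\<forall>S\<in>P. v S + \<epsilon> \<le> sum x S"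
    by (auto simp: strong_core_def)
  moreover have "sum x U = v N - t"
    using \<open>sum x N = v N\<close> x finite_U a_notin_U by simp
  ultimately show "\<exists>x. (\<forall>S\<in>P. (\<Sum>i\<in>U. row S i * x i) \<le> rhs \<epsilon> S) \<and> sum x U = v N - t"
    using core_constraint_iff by blast
next
  assume "\<exists>x. (\<forall>S\<in>P. (\<Sum>i\<in>U. row S i * x i) \<le> rhs \<epsilon> S) \<and> sum x U = v N - t"
  then obtain x where x: "\<forall>S\<in>P. (\<Sum>i\<in>U. row S i * x i) \<le> rhs \<epsilon> S" "sum x U = v N - t"
    by blast
  \<comment> \<open>The linear system says nothing about \<open>x\<close> outside \<open>U\<close>:
    the value at \<open>a\<close> is set, and the restriction makes \<open>z\<close> extensional as
    \<open>strong_core\<close> demands.\<close>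
  define z where "z = restrict (x(a := t)) N"
  have z_U: "z i = x i" if "i \<in> U" for i using that a_notin_U by (auto simp: z_def)
  have "z a = t" by (simp add: z_def)
  then have "sum z N = v N"
    using x finite_U a_notin_U z_U by simp
  moreover have "\<forall>S\<in>P. (\<Sum>i\<in>U. row S i * z i) \<le> rhs \<epsilon> S"
    using x z_U by simp
  moreover have "z \<in> extensional N" by (simp add: z_def)
  ultimately have "z \<in> strong_core N v \<epsilon>"
    unfolding strong_core_def using core_constraint_iff by blast
  with \<open>z a = t\<close> show "\<exists>x\<in>strong_core N v \<epsilon>. x a = t" by blast
qed

lemma strong_core_nonempty_iff:
  "strong_core N v \<epsilon> \<noteq> {} \<longleftrightarrow> (\<exists>x. \<forall>S\<in>P. (\<Sum>i\<in>U. row S i * x i) \<le> rhs \<epsilon> S)"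
proof -
  have "strong_core N v \<epsilon> \<noteq> {} \<longleftrightarrow> (\<exists>t. \<exists>x\<in>strong_core N v \<epsilon>. x a = t)" by auto
  also have "\<dots> \<longleftrightarrow> (\<exists>x. \<forall>S\<in>P. (\<Sum>i\<in>U. row S i * x i) \<le> rhs \<epsilon> S)"
  proof -
    have "\<exists>t. sum x U = v N - t" for x
      by (rule exI[of _ "v N - sum x U"]) simp
    then show ?thesis unfolding core_share_iff by blast
  qed
  finally show ?thesis .
qed

section \<open>Attainment of the least core value and of the minimum share\<close>

text \<open>The admissible \<open>\<epsilon>\<close> form a nonempty closed set that is bounded
  above, so the supremum belongs to it and is the value of \<open>GREATEST\<close>.\<close>

lemma least_core_nonempty: "least_core N v \<noteq> {}"
proof -
  let ?E = "{\<epsilon>. strong_core N v \<epsilon> \<noteq> {}}"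
  have "?E = {\<epsilon>. \<exists>x. \<forall>S\<in>P. (\<Sum>i\<in>U. row S i * x i) \<le> rhs 0 S + \<epsilon> * (- 1)}"
    unfolding strong_core_nonempty_iff by (simp add: rhs_def if_distrib cong: if_cong)
  then have closed: "closed ?E"
    using closed_feasible_parameters[OF finite_P finite_U, of row "rhs 0" "\<lambda>_. - 1"] by simp
  \<comment> \<open>With this \<open>\<epsilon>\<close> the zero vector satisfies every constraint,
    as \<open>\<epsilon>\<close> is subtracted from each right-hand side.\<close>
  have "Min (rhs 0 ` P) \<le> rhs 0 S" if "S \<in> P" for S
    using that finite_P by auto
  then have "\<forall>S\<in>P. (\<Sum>i\<in>U. row S i * 0) \<le> rhs (Min (rhs 0 ` P)) S"
    by (force simp: rhs_def split: if_splits)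
  then have "Min (rhs 0 ` P) \<in> ?E"
    unfolding mem_Collect_eq strong_core_nonempty_iff by (intro exI[of _ "\<lambda>_. 0"])
  then have nonempty: "?E \<noteq> {}" by blast
  \<comment> \<open>The coalitions \<open>{a}\<close> and \<open>U\<close> are complementary, so
    adding their two constraints bounds \<open>2 * \<epsilon>\<close>.\<close>
  have "\<epsilon> \<le> (v N - v {a}) / 2" if \<epsilon>: "\<epsilon> \<in> ?E" for \<epsilon>
  proof -
    obtain x where "x \<in> strong_core N v \<epsilon>" using \<epsilon> by auto
    then have "sum x N = v N" "v {a} + \<epsilon> \<le> sum x {a}" "v U + \<epsilon> \<le> sum x U"
      using singleton_a_in_P U_in_P by (auto simp: strong_core_def simp del: sum.insert)
    then show ?thesis using finite_U a_notin_U v_without_a[of U] by simp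
  qed
  then have bdd: "bdd_above ?E" by (intro bdd_aboveI[of _ "(v N - v {a}) / 2"]) auto
  have "\<epsilon>\<^sub>0 = Sup ?E"
    unfolding least_core_value_def
    using closed_contains_Sup[OF nonempty bdd closed] cSup_upper[OF _ bdd]
    by (intro Greatest_equality) auto
  then show ?thesis
    using closed_contains_Sup[OF nonempty bdd closed] by (simp add: least_core_def)
qed

lemma min_share_least:
  shows min_share_attained: "\<exists>x\<in>least_core N v. x a = m\<^sub>a"
    and min_share_le: "x \<in> least_core N v \<Longrightarrow> m\<^sub>a \<le> x a"
proof -
  \<comment> \<open>Relaxing \<open>x a = t\<close> to \<open>x a \<le> t\<close> leaves the infimum
    unchanged and turns the share condition into a single inequality, row \<open>None\<close>, whose
    right-hand side is affine in \<open>t\<close>. Closedness then yields an attained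
    minimum.\<close>
  let ?T = "{t. \<exists>x\<in>least_core N v. x a \<le> t}"
  define A where "A = case_option (\<lambda>_. - 1) row"
  define b where "b = case_option (- v N) (rhs \<epsilon>\<^sub>0)"
  define d where "d = case_option 1 (\<lambda>_::'p set. 0::real)"
  have "t \<in> ?T \<longleftrightarrow> (\<exists>x. \<forall>j\<in>insert None (Some ` P). (\<Sum>i\<in>U. A j i * x i) \<le> b j + t * d j)" for t
  proof -
    have "t \<in> ?T \<longleftrightarrow> (\<exists>s\<le>t. \<exists>x\<in>strong_core N v \<epsilon>\<^sub>0. x a = s)"
      by (auto simp: least_core_def)
    also have "\<dots> \<longleftrightarrow> (\<exists>x. (\<forall>S\<in>P. (\<Sum>i\<in>U. row S i * x i) \<le> rhs \<epsilon>\<^sub>0 S) \<and>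
        (\<exists>s\<le>t. sum x U = v N - s))"
      unfolding core_share_iff by blast
    also have "\<dots> \<longleftrightarrow> (\<exists>x. (\<forall>S\<in>P. (\<Sum>i\<in>U. row S i * x i) \<le> rhs \<epsilon>\<^sub>0 S) \<and>
        - sum x U \<le> - v N + t)"
    proof -
      have "(\<exists>s\<le>t. sum x U = v N - s) \<longleftrightarrow> - sum x U \<le> - v N + t" for x
        by (auto intro!: exI[of _ "v N - sum x U"])
      then show ?thesis by simp
    qed
    finally show ?thesis
      by (simp add: A_def b_def d_def sum_negf conj_commute)
  qed
  then have "?T = {t. \<exists>x. \<forall>j\<in>insert None (Some ` P). (\<Sum>i\<in>U. A j i * x i) \<le> b j + t * d j}"
    by blast
  then have closed: "closed ?T"
    using closed_feasible_parameters[of "insert None (Some ` P)" U A b d] finite_P finite_U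
    by simp
  have nonempty: "?T \<noteq> {}" using least_core_nonempty by blast
  have "v {a} + \<epsilon>\<^sub>0 \<le> t" if t: "t \<in> ?T" for t
  proof -
    obtain x where "x \<in> least_core N v" "x a \<le> t" using t by blast
    then have "v {a} + \<epsilon>\<^sub>0 \<le> sum x {a}"
      using singleton_a_in_P unfolding least_core_def strong_core_def by blast
    with \<open>x a \<le> t\<close> show ?thesis by simp
  qed
  then have bdd: "bdd_below ?T" by (intro bdd_belowI[of _ "v {a} + \<epsilon>\<^sub>0"]) auto
  have lower: "Inf ?T \<le> x a" if "x \<in> least_core N v" for x
    using that by (intro cInf_lower[OF _ bdd]) auto
  obtain z where z: "z \<in> least_core N v" "z a \<le> Inf ?T"
    using closed_contains_Inf[OF nonempty bdd closed] by blast
  then have "z a = Inf ?T" using lower[OF z(1)] by simp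
  then have "m\<^sub>a = z a"
    unfolding min_share_def using z(1) lower
    by (intro Least_equality CollectI exI[of _ z]) auto
  then show "\<exists>x\<in>least_core N v. x a = m\<^sub>a" "x \<in> least_core N v \<Longrightarrow> m\<^sub>a \<le> x a"
    using z(1) \<open>z a = Inf ?T\<close> lower[of x] by metis+
qed

section \<open>Linear programming duality for the aggregator's share\<close>

lemma dual_feasible_iff:
  "dual_feasible U a lam \<longleftrightarrow> lam \<in> extensional P \<and> (\<forall>S\<in>P. 0 \<le> lam S) \<and>
    (\<forall>i\<in>U. (\<Sum>S\<in>P. lam S * row S i) = 1)"
proof -
  have "(\<Sum>S | S \<in> P \<and> a \<in> S \<and> i \<notin> S. lam S) - (\<Sum>S | S \<in> P \<and> a \<notin> S \<and> i \<in> S. lam S)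
      = (\<Sum>S\<in>P. lam S * row S i)" for i
    unfolding sum.inter_filter[OF finite_P] sum_subtractf[symmetric]
    by (intro sum.cong) (auto simp: row_def)
  then show ?thesis by (simp add: dual_feasible_def Let_def)
qed

lemma dual_objective_eq:
  "dual_objective U a v lam = (\<Sum>S\<in>P. lam S * rhs \<epsilon>\<^sub>0 S)"
  unfolding dual_objective_def Let_def sum.inter_filter[OF finite_P] sum_distrib_left
    sum_subtractf[symmetric]
  by (intro sum.cong) (auto simp: rhs_def)

text \<open>Dual feasibility says that the weighted rows add up to x(U). Evaluate this at a least
  core point where the aggregator gets \<open>m\<^sub>a\<close>.\<close>

lemma weak_duality:
  assumes "dual_feasible U a lam"
  shows "v N - m\<^sub>a \<le> dual_objective U a v lam"
proof -
  obtain x where x: "\<forall>S\<in>P. (\<Sum>i\<in>U. row S i * x i) \<le> rhs \<epsilon>\<^sub>0 S" "sum x U = v N - m\<^sub>a"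
    using min_share_attained core_share_iff unfolding least_core_def by blast
  have "(\<Sum>i\<in>U. (\<Sum>S\<in>P. lam S * row S i) * x i) \<le> dual_objective U a v lam"
    unfolding dual_objective_eq
    using assms x by (intro certificate_bound) (auto simp: dual_feasible_iff)
  also have "(\<Sum>i\<in>U. (\<Sum>S\<in>P. lam S * row S i) * x i) = sum x U"
    using assms by (intro sum.cong) (auto simp: dual_feasible_iff)
  finally show ?thesis using x by simp
qed

text \<open>Strong duality in approximate form. For \<open>t < m\<^sub>a\<close> the core
  constraints exclude x(U) of at least \<open>v N - t\<close>; the Farkas certificate of this
  infeasibility, divided by the multiplier of the share row, is the dual point.\<close>

lemma dual_approximation:
  assumes "t < m\<^sub>a"
  obtains mu where "dual_feasible U a mu" "dual_objective U a v mu < v N - t"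
proof -
  define A where "A = case_option (\<lambda>_. - 1) row"
  define b where "b = case_option (t - v N) (rhs \<epsilon>\<^sub>0)"
  let ?J = "insert None (Some ` P)"
  have sums: "(\<Sum>j\<in>?J. h j) = h None + (\<Sum>S\<in>P. h (Some S))" for h :: "'p set option \<Rightarrow> real"
    using finite_P by (simp add: sum.reindex)
  have "\<nexists>x. \<forall>j\<in>?J. (\<Sum>i\<in>U. A j i * x i) \<le> b j"
  proof
    assume "\<exists>x. \<forall>j\<in>?J. (\<Sum>i\<in>U. A j i * x i) \<le> b j"
    then obtain x where x: "\<forall>S\<in>P. (\<Sum>i\<in>U. row S i * x i) \<le> rhs \<epsilon>\<^sub>0 S" "v N - t \<le> sum x U"
      by (auto simp: A_def b_def sum_negf)
    then have "\<exists>z\<in>least_core N v. z a = v N - sum x U"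
      unfolding least_core_def core_share_iff by auto
    then show False using min_share_le x(2) assms by fastforce
  qed
  then obtain y where y: "\<forall>j\<in>?J. 0 \<le> y j" "\<forall>i\<in>U. (\<Sum>j\<in>?J. y j * A j i) = 0" "(\<Sum>j\<in>?J. y j * b j) < 0"
    using farkas[of ?J U A b] finite_P finite_U by auto
  let ?\<mu> = "y None"
  have eq: "(\<Sum>S\<in>P. y (Some S) * row S i) = ?\<mu>" if "i \<in> U" for i
    using bspec[OF y(2) that] unfolding sums by (simp add: A_def)
  have less: "(\<Sum>S\<in>P. y (Some S) * rhs \<epsilon>\<^sub>0 S) < ?\<mu> * (v N - t)"
    using y(3) unfolding sums by (simp add: b_def right_diff_distrib)
  have "?\<mu> \<noteq> 0"
  proof
    \<comment> \<open>A vanishing multiplier of the share constraint would make the least core empty.\<close>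
    assume "?\<mu> = 0"
    obtain x where "\<forall>S\<in>P. (\<Sum>i\<in>U. row S i * x i) \<le> rhs \<epsilon>\<^sub>0 S"
      using least_core_nonempty strong_core_nonempty_iff unfolding least_core_def by blast
    then have "(\<Sum>i\<in>U. (\<Sum>S\<in>P. y (Some S) * row S i) * x i) \<le> (\<Sum>S\<in>P. y (Some S) * rhs \<epsilon>\<^sub>0 S)"
      using y(1) by (intro certificate_bound) auto
    then show False using less eq \<open>?\<mu> = 0\<close> by simp
  qed
  then have pos: "?\<mu> > 0" using y(1) by simp
  define mu where "mu = restrict (\<lambda>S. y (Some S) / ?\<mu>) P"
  have scaled: "(\<Sum>S\<in>P. mu S * g S) = (\<Sum>S\<in>P. y (Some S) * g S) / ?\<mu>" for g
    by (simp add: mu_def sum_divide_distrib)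
  have "dual_feasible U a mu"
    unfolding dual_feasible_iff scaled using eq pos y(1) by (auto simp: mu_def)
  moreover have "dual_objective U a v mu < v N - t"
    unfolding dual_objective_eq scaled using less pos by (simp add: pos_divide_less_eq mult.commute)
  ultimately show thesis by (rule that)
qed

text \<open>The approximate form suffices: were the value of an optimal \<open>lam\<close> above
  \<open>v N - m\<^sub>a\<close>, then \<open>t = v N - dual_objective U a v lam\<close> would lie
  below \<open>m\<^sub>a\<close> and give a strictly better dual point.\<close>

lemma dual_optimal_iff:
  "dual_optimal U a v lam \<longleftrightarrow>
    dual_feasible U a lam \<and> dual_objective U a v lam = v N - m\<^sub>a"
proof -
  have "dual_objective U a v lam \<le> v N - m\<^sub>a" if opt: "dual_optimal U a v lam"
  proof (rule ccontr)
    assume "\<not> ?thesis"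
    then have "v N - dual_objective U a v lam < m\<^sub>a" by simp
    then obtain mu where "dual_feasible U a mu"
        "dual_objective U a v mu < dual_objective U a v lam"
      using dual_approximation by force
    with opt show False by (force simp: dual_optimal_def)
  qed
  then show ?thesis
    using weak_duality unfolding dual_optimal_def by (metis order_antisym)
qed

section \<open>Partitions of the users as dual solutions\<close>

text \<open>A part \<open>T\<close> enters through its complement because \<open>N - T\<close>
  contains \<open>a\<close> and \<open>row (N - T)\<close> is, on \<open>U\<close>, the indicator of
  \<open>T\<close>.\<close>

definition partition_dual :: "'p set set \<Rightarrow> 'p set \<Rightarrow> real" where
  "partition_dual A = restrict (\<lambda>S. of_bool (N - S \<in> A)) P"

definition partition_bound :: "'p set set \<Rightarrow> real" where
  "partition_bound A = real (card A) * (v N - \<epsilon>\<^sub>0) - (\<Sum>S\<in>A. v (N - S))"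

lemma partition_part:
  assumes "partition_on U A" "T \<in> A"
  shows "T \<in> P" "T \<subseteq> U" "T \<noteq> {}"
proof -
  show "T \<subseteq> U" "T \<noteq> {}" using assms by (auto simp: partition_on_def)
  then show "T \<in> P" using a_notin_U by (auto simp: proper_coalitions_def)
qed

text \<open>Reindexing by complements. It is stated for any \<open>lam\<close> with such support, so
  that it covers both \<open>partition_dual\<close> and an optimal solution whose shape is still to
  be found.\<close>

lemma sum_over_partition:
  fixes lam g :: "'p set \<Rightarrow> real"
  assumes A: "partition_on U A" and supp: "\<And>S. S \<in> P \<Longrightarrow> N - S \<notin> A \<Longrightarrow> lam S = 0"
  shows "(\<Sum>S\<in>P. lam S * g S) = (\<Sum>T\<in>A. lam (N - T) * g (N - T))"
proof -
  have T: "T \<subseteq> N" "N - T \<in> P" if "T \<in> A" for T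
    using partition_part[OF A that] diff_in_P_iff[of T] by auto
  have "(\<Sum>S\<in>P. lam S * g S) = (\<Sum>S | S \<in> P \<and> N - S \<in> A. lam S * g S)"
    using finite_P by (intro sum.mono_neutral_right) (auto simp: supp)
  also have "\<dots> = (\<Sum>T\<in>A. lam (N - T) * g (N - T))"
    using T by (intro sum.reindex_bij_witness[of _ "\<lambda>T. N - T" "\<lambda>S. N - S"])
      (auto simp: double_diff proper_coalitions_def)
  finally show ?thesis .
qed

text \<open>Only the part containing \<open>i\<close> contributes, since the parts are
  disjoint.\<close>

lemma sum_row_partition:
  assumes A: "partition_on U A" and T: "T \<in> A" "i \<in> T"
  shows "(\<Sum>T'\<in>A. h T' * row (N - T') i) = h T"
proof -
  have "h T' * row (N - T') i = (if T' = T then h T else 0)" if "T' \<in> A" for T'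
  proof -
    have "i \<in> T' \<longleftrightarrow> T' = T"
      using A T that unfolding partition_on_def disjoint_def by blast
    then show ?thesis
      using partition_part[OF A that] partition_part[OF A T(1)] T a_notin_U
      by (auto simp: row_def)
  qed
  then show ?thesis
    using finite_elements[OF finite_U A] T by (simp cong: sum.cong)
qed

lemma partition_dual_feasible:
  assumes A: "partition_on U A"
  shows "dual_feasible U a (partition_dual A)"
proof -
  have T: "partition_dual A (N - T) = 1" if "T \<in> A" for T
  proof -
    have "N - (N - T) = T" "N - T \<in> P"
      using partition_part[OF A that] diff_in_P_iff[of T] by auto
    then show ?thesis using that by (simp add: partition_dual_def)
  qed
  have "(\<Sum>S\<in>P. partition_dual A S * row S i) = 1" if i: "i \<in> U" for i
  proof -
    obtain T where "T \<in> A" "i \<in> T" using A i by (auto simp: partition_on_def)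
    then show ?thesis
      using sum_row_partition[OF A, of T i "\<lambda>T. partition_dual A (N - T)"] T
      by (subst sum_over_partition[OF A]) (auto simp: partition_dual_def)
  qed
  then show ?thesis by (auto simp: dual_feasible_iff partition_dual_def)
qed

lemma partition_dual_objective:
  assumes A: "partition_on U A"
  shows "dual_objective U a v (partition_dual A) = partition_bound A"
proof -
  have "dual_objective U a v (partition_dual A)
      = (\<Sum>T\<in>A. partition_dual A (N - T) * rhs \<epsilon>\<^sub>0 (N - T))"
    unfolding dual_objective_eq
    by (rule sum_over_partition[OF A]) (simp add: partition_dual_def)
  also have "\<dots> = (\<Sum>T\<in>A. v N - \<epsilon>\<^sub>0 - v (N - T))"
  proof (rule sum.cong)
    fix T assume "T \<in> A"
    note T = partition_part[OF A this]
    then have "N - (N - T) = T" "a \<notin> T" "N - T \<in> P"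
      using a_notin_U diff_in_P_iff[of T] by auto
    then show "partition_dual A (N - T) * rhs \<epsilon>\<^sub>0 (N - T) = v N - \<epsilon>\<^sub>0 - v (N - T)"
      using \<open>T \<in> A\<close> by (simp add: partition_dual_def rhs_def)
  qed simp
  finally show ?thesis by (simp add: partition_bound_def sum_subtractf)
qed

lemma partition_dual_support:
  assumes A: "partition_on U A"
  shows "{S \<in> P. partition_dual A (N - S) > 0} = A"
proof -
  have "S \<in> P \<and> partition_dual A (N - S) > 0 \<longleftrightarrow> S \<in> P \<and> S \<in> A" for S
  proof (cases "S \<in> P")
    case True
    then have "N - (N - S) = S" "N - S \<in> P"
      using diff_in_P_iff[of S] by (auto simp: proper_coalitions_def)
    then show ?thesis by (simp add: partition_dual_def)
  qed simp
  then show ?thesis using partition_part(1)[OF A] by auto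
qed

text \<open>Off the complements of the parts, \<open>lam\<close> is nonnegative but not positive,
  hence 0. Each part \<open>T\<close> is nonempty, and the dual constraint at any of its users
  reduces to \<open>lam (N - T) = 1\<close>.\<close>

lemma partition_support_unique:
  assumes lam: "dual_feasible U a lam" and A: "partition_on U A"
    and A_def: "A = {S \<in> P. lam (N - S) > 0}"
  shows "lam = partition_dual A"
proof (rule extensionalityI)
  show "lam \<in> extensional P" "partition_dual A \<in> extensional P"
    using lam by (auto simp: dual_feasible_iff partition_dual_def)
  fix S assume S: "S \<in> P"
  have supp: "lam R = 0" if "R \<in> P" "N - R \<notin> A" for R
  proof -
    have "N - (N - R) = R" "N - R \<in> P"
      using that diff_in_P_iff[of R] by (auto simp: proper_coalitions_def)
    then have "\<not> lam R > 0" using that by (simp add: A_def)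
    then show ?thesis using lam that by (force simp: dual_feasible_iff)
  qed
  show "lam S = partition_dual A S"
  proof (cases "N - S \<in> A")
    case True
    then obtain i where i: "i \<in> N - S" "i \<in> U" using partition_part[OF A True] by blast
    have "1 = (\<Sum>R\<in>P. lam R * row R i)" using lam i by (simp add: dual_feasible_iff)
    also have "\<dots> = (\<Sum>T\<in>A. lam (N - T) * row (N - T) i)"
      by (rule sum_over_partition[OF A supp])
    also have "\<dots> = lam (N - (N - S))"
      by (rule sum_row_partition[OF A True i(1)])
    also have "N - (N - S) = S" using S by (auto simp: proper_coalitions_def)
    finally show ?thesis using True S by (simp add: partition_dual_def)
  next
    case False
    then show ?thesis using supp[OF S] S by (simp add: partition_dual_def)
  qed
qed

theorem min_share_bound:
  defines "B \<equiv> {partition_bound A | A. partition_on U A}"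
  shows "v N - Min B \<le> m\<^sub>a"
    and "m\<^sub>a = v N - Min B \<longleftrightarrow>
      (\<exists>lam. dual_optimal U a v lam \<and> partition_on U {S \<in> P. lam (N - S) > 0})"
proof -
  \<comment> \<open>\<open>Min\<close> is meaningful: there are finitely many partitions, and
    \<open>{U}\<close> is one of them.\<close>
  have "finite {A. partition_on U A}"
    using finite_U by (rule finitely_many_partition_on)
  then have fin: "finite B" unfolding B_def by simp
  have "partition_on U {U}" using U_nonempty by (rule partition_on_space)
  then have "B \<noteq> {}" unfolding B_def by blast
  then have "Min B \<in> B" using fin by simp
  then obtain A where A: "partition_on U A" "partition_bound A = Min B" unfolding B_def by auto
  show bound: "v N - Min B \<le> m\<^sub>a"
    using weak_duality[OF partition_dual_feasible[OF A(1)]] A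
    by (simp add: partition_dual_objective)
  show "m\<^sub>a = v N - Min B \<longleftrightarrow>
      (\<exists>lam. dual_optimal U a v lam \<and> partition_on U {S \<in> P. lam (N - S) > 0})"
  proof
    assume "m\<^sub>a = v N - Min B"
    then have "dual_optimal U a v (partition_dual A)"
      using A by (simp add: dual_optimal_iff partition_dual_feasible partition_dual_objective)
    then show "\<exists>lam. dual_optimal U a v lam \<and> partition_on U {S \<in> P. lam (N - S) > 0}"
      using A partition_dual_support by metis
  next
    assume "\<exists>lam. dual_optimal U a v lam \<and> partition_on U {S \<in> P. lam (N - S) > 0}"
    then obtain lam where lam: "dual_optimal U a v lam"
        "partition_on U {S \<in> P. lam (N - S) > 0}" (is "partition_on U ?A") by blast
    then have "lam = partition_dual ?A"
      using partition_support_unique by (simp add: dual_optimal_iff)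
    \<comment> \<open>The optimal value is itself a partition bound, hence at least
      \<open>Min B\<close>; this is the inequality opposite to \<open>bound\<close>.\<close>
    then have "partition_bound ?A = v N - m\<^sub>a"
      using lam partition_dual_objective by (metis dual_optimal_iff)
    moreover have "Min B \<le> partition_bound ?A"
      using lam(2) fin unfolding B_def by (intro Min_le) auto
    ultimately show "m\<^sub>a = v N - Min B" using bound by simp
  qed
qed

end

theorem theorem9:
  fixes U N :: "'p set" and a :: 'p and n :: "'p \<Rightarrow> nat"
    and D :: "'p \<Rightarrow> ('m::finite) point set"
    and f :: "'p \<Rightarrow> 'm point \<Rightarrow> real"
    and c :: "'p \<Rightarrow> real"
    and fa :: "real ^ 'm \<Rightarrow> real"
    and v :: "'p set \<Rightarrow> real"
    and \<epsilon> m\<^sub>a bound :: real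
  assumes "finite U" and "card U \<ge> 2" and "a \<notin> U"
    and "\<And>i. i \<in> U \<Longrightarrow> D i \<subseteq> extensional {..<n i} \<times> {0..} \<times> {0..}"
    and "\<And>i. i \<in> U \<Longrightarrow> compact (D i)"
    and "\<And>i. i \<in> U \<Longrightarrow> {z. (z, 0) \<in> D i} \<noteq> {}"
    and "\<And>i. i \<in> U \<Longrightarrow> continuous_on (extensional {..<n i} \<times> UNIV) (f i)"
    and "\<And>i. i \<in> U \<Longrightarrow> c i \<ge> 0"
    and "continuous_on UNIV fa" and "\<And>w. fa w \<ge> 0" and "fa 0 = 0"
    and "N = insert a U"
    and "v = sharing_value U a D f c fa"
    and "\<epsilon> = least_core_value N v"
    and "m\<^sub>a = min_share N v a"
    and "bound = v N - Min {real (card A) * (v N - \<epsilon>) - (\<Sum>S\<in>A. v (N - S)) | A. partition_on U A}"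
  shows "m\<^sub>a \<ge> bound \<and>
    (m\<^sub>a = bound \<longleftrightarrow>
      (\<exists>lam. dual_optimal U a v lam \<and> partition_on U {S \<in> proper_coalitions N. lam (N - S) > 0}))"
proof -
  \<comment> \<open>\<open>U\<close> is nonempty as it has at least two users, and the condition
    \<open>a \<in> S\<close> in \<open>sharing_value\<close> makes \<open>v\<close> vanish on
    coalitions without \<open>a\<close>.\<close>
  interpret aggregator_game U a v
    using assms by unfold_locales (auto simp: sharing_value_def)
  show ?thesis
    using min_share_bound unfolding partition_bound_def assms(12,14-16) by simp
qed

end
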